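(* Let $\alpha\in(0,1)$ and suppose $(X_i,Y_i,U_i)_{i=1,\dots,n}$ and $(X_{n+1},Y_{n+1},U_{n+1})$ are i.i.d. draws, where $X_i\in\mathbb{R}^d$, $Y_i\in\mathcal{Y}=\{1,\dots,K\}$, and $U_i$ is uniform on $[0,1]$ (taking values in $[0,1]$). Let $k^*$ be the smallest $k\in\{1,\dots,K\}$ such that the top-$k$ predictive sets have coverage at least $\lceil(n+1)(1-\alpha)\rceil/n$ on the conformal calibration points $(X_i,Y_i)_{i=1,\dots,n}$, that is, such that $$\frac{|\{i\in\{1,\dots,n\} : Y_i\in\{\hat{y}_{(1)}(X_i),\dots,\hat{y}_{(k)}(X_i)\}\}|}{n}\ge\frac{\lceil(n+1)(1-\alpha)\rceil}{n}$$ (it is assumed that such a $k$ exists). Let $$\mathcal{C}^*(x,u,\tau)=\Big\{y\in\mathcal{Y} : \rho_x(y)+\hat{\pi}_x(y)\cdot u+\lambda\cdot(o_x(y)-k_{reg})^+\le\tau\Big\}$$ with $\lambda=1$ and any $0\le k_{reg}\le k^*$, and let $$\hat{\tau}_{\mathrm{ccal}}=\inf\left\{\tau\in\mathbb{R} : \frac{|\{i\in\{1,\dots,n\} : Y_i\in\mathcal{C}^*(X_i,U_i,\tau)\}|}{n}\ge\frac{\lceil(n+1)(1-\alpha)\rceil}{n}\right\}.$$ Then $$\mathcal{C}^*(X_{n+1},U_{n+1},\hat{\tau}_{\mathrm{ccal}})\subseteq\{\hat{y}_{(1)}(X_{n+1}),\dots,\hat{y}_{(k^* )}(X_{n+1}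)\}.$$
   Context: Let $\mathcal{Y}=\{1,\dots,K\}$ be the finite set of labels. A fixed (non-random, i.e. trained on separate data), measurable base classifier assigns to every feature vector $x\in\mathbb{R}^d$ a probability vector $\hat{\pi}_x=(\hat{\pi}_x(1),\dots,\hat{\pi}_x(K))$, with $\hat{\pi}_x(y)\ge 0$ and $\sum_{y}\hat{\pi}_x(y)=1$. It is assumed that for each $x$ the values $\hat{\pi}_x(1),\dots,\hat{\pi}_x(K)$ are distinct. Notation: $\rho_x(y)=\sum_{y'=1}^K\hat{\pi}_x(y')\,\mathbb{I}_{\{\hat{\pi}_x(y')>\hat{\pi}_x(y)\}}$ is the total probability mass of labels strictly more likely than $y$; $o_x(y)=|\{y'\in\mathcal{Y}:\hat{\pi}_x(y')\ge\hat{\pi}_x(y)\}|$ is the rank of $y$ when labels are ordered from most to least likely; $(z)^+=\max(z,0)$ is the positive part of $z$. For a feature vector $x$, $\hat{y}_{(j)}(x)$ denotes the label with the $j$th highest predicted probability $\hat{\pi}_x(\cdot)$, and the top-$k$ predictive set at $x$ is $\{\hat{y}_{(1)}(x),\dots,\hat{y}_{(k)}(x)\}$. *)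

theory Defs
  imports "HOL-Probability.Probability"
begin

text \<open>
  The labels are \<open>{1..K}\<close>. In the first group of definitions, \<open>p\<close> is the probability vector that
  the classifier assigns to one fixed feature vector; only its values on \<open>{1..K}\<close> matter.
\<close>

definition mass_above :: "nat \<Rightarrow> (nat \<Rightarrow> real) \<Rightarrow> nat \<Rightarrow> real" where
  "mass_above K p y = (\<Sum>y'\<in>{1..K}. p y' * of_bool (p y' > p y))"

definition label_rank :: "nat \<Rightarrow> (nat \<Rightarrow> real) \<Rightarrow> nat \<Rightarrow> nat" where
  "label_rank K p y = card {y' \<in> {1..K}. p y' \<ge> p y}"

text \<open>The index \<open>j\<close> counts from 1 to \<open>K\<close>, most likely label first; lists are indexed from 0.\<close>

definition jth_label :: "nat \<Rightarrow> (nat \<Rightarrow> real) \<Rightarrow> nat \<Rightarrow> nat" where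
  "jth_label K p j = sort_key (\<lambda>y. - p y) [1..<Suc K] ! (j - 1)"

definition top_set :: "nat \<Rightarrow> (nat \<Rightarrow> real) \<Rightarrow> nat \<Rightarrow> nat set" where
  "top_set K p k = jth_label K p ` {1..k}"

definition C_star ::
  "nat \<Rightarrow> (nat \<Rightarrow> real) \<Rightarrow> real \<Rightarrow> real \<Rightarrow> real \<Rightarrow> real \<Rightarrow> nat set" where
  "C_star K p lam k_reg u \<tau> =
     {y \<in> {1..K}. mass_above K p y + p y * u
                    + lam * max (real (label_rank K p y) - k_reg) 0 \<le> \<tau>}"

text \<open>
  Below, \<open>\<pi> x\<close> is the probability vector at \<open>x\<close>, and \<open>x i\<close>, \<open>y i\<close>, \<open>u i\<close> are the realised
  values of the data; the calibration points are those with index in \<open>{1..n}\<close>.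
\<close>

definition calib_coverage :: "nat \<Rightarrow> real \<Rightarrow> (nat \<Rightarrow> nat) \<Rightarrow> (nat \<Rightarrow> nat set) \<Rightarrow> bool" where
  "calib_coverage n \<alpha> y A \<longleftrightarrow>
     real (card {i \<in> {1..n}. y i \<in> A i}) / real n
       \<ge> real_of_int \<lceil>(real n + 1) * (1 - \<alpha>)\<rceil> / real n"

definition k_star ::
  "nat \<Rightarrow> ('x \<Rightarrow> nat \<Rightarrow> real) \<Rightarrow> nat \<Rightarrow> real \<Rightarrow> (nat \<Rightarrow> 'x) \<Rightarrow> (nat \<Rightarrow> nat) \<Rightarrow> nat" where
  "k_star K \<pi> n \<alpha> x y =
     (LEAST k. k \<in> {1..K} \<and> calib_coverage n \<alpha> y (\<lambda>i. top_set K (\<pi> (x i)) k))"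

definition tau_ccal ::
  "nat \<Rightarrow> ('x \<Rightarrow> nat \<Rightarrow> real) \<Rightarrow> real \<Rightarrow> real \<Rightarrow> nat \<Rightarrow> real
     \<Rightarrow> (nat \<Rightarrow> 'x) \<Rightarrow> (nat \<Rightarrow> nat) \<Rightarrow> (nat \<Rightarrow> real) \<Rightarrow> real" where
  "tau_ccal K \<pi> lam k_reg n \<alpha> x y u =
     Inf {\<tau>. calib_coverage n \<alpha> y (\<lambda>i. C_star K (\<pi> (x i)) lam k_reg (u i) \<tau>)}"

end

theory Submission imports Defs begin

text \<open>
  A label of rank at most \<open>k\<^sup>*\<close> has score at most \<open>1 + (k\<^sup>* - k_reg)\<close>, because the randomised
  cumulative mass never exceeds 1. At this threshold the regularised sets therefore cover every
  calibration point that the top-\<open>k\<^sup>*\<close> sets cover, so it bounds \<open>\<tau>_ccal\<close> from above. A label of rank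
  at least \<open>k\<^sup>* + 1 \<ge> 2\<close> pays a penalty of at least this threshold, and the mass above it is strictly
  positive, so its score exceeds the threshold and the label is excluded.
\<close>

text \<open>Injectivity of \<open>p\<close> turns the sorted list into a strictly decreasing one, so
  a position in the list can be recovered by counting the labels that are at least as
  likely.\<close>

lemma
  assumes inj: "inj_on p {1..K}" and j: "j \<in> {1..K}"
  shows jth_label_in: "jth_label K p j \<in> {1..K}"
    and label_rank_jth_label: "label_rank K p (jth_label K p j) = j"
proof -
  define xs where "xs = sort_key (\<lambda>y. - p y) [1..<Suc K]"
  have set_xs: "set xs = {1..K}" and dist: "distinct xs" and len: "length xs = K"
    unfolding xs_def by auto
  have sorted: "sorted (map (\<lambda>y. - p y) xs)"
    unfolding xs_def by simp
  have anti: "p (xs ! b) < p (xs ! a)" if "a < b" "b < K" for a b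
  proof -
    have "p (xs ! b) \<le> p (xs ! a)"
      using sorted_nth_mono[OF sorted, of a b] that len by simp
    moreover have "xs ! a \<noteq> xs ! b"
      using dist that len by (simp add: nth_eq_iff_index_eq)
    moreover have "xs ! a \<in> {1..K}" "xs ! b \<in> {1..K}"
      using that len set_xs nth_mem[of _ xs] by auto
    ultimately show ?thesis
      using inj_onD[OF inj, of "xs ! a" "xs ! b"] by fastforce
  qed
  have jth: "jth_label K p j = xs ! (j - 1)"
    unfolding jth_label_def xs_def ..
  show "jth_label K p j \<in> {1..K}"
    using j len set_xs nth_mem[of "j - 1" xs] jth by auto
  \<comment> \<open>List indices start at 0: the \<open>j\<close>-th label sits at
    \<open>j - 1\<close> and counts towards its own rank, hence exactly \<open>j\<close> positions.
    Both inclusions follow from the strict decrease \<open>anti\<close>.\<close>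
  have "{y \<in> {1..K}. p y \<ge> p (xs ! (j - 1))} = (!) xs ` {..<j}"
  proof (intro subset_antisym subsetI)
    fix y assume "y \<in> {y \<in> {1..K}. p y \<ge> p (xs ! (j - 1))}"
    then obtain a where a: "a < K" "y = xs ! a" and "p (xs ! a) \<ge> p (xs ! (j - 1))"
      using set_xs len by (metis (no_types, lifting) in_set_conv_nth mem_Collect_eq)
    then have "a \<le> j - 1"
      using anti[of "j - 1" a] by fastforce
    then show "y \<in> (!) xs ` {..<j}"
      using a j by auto
  next
    fix y assume "y \<in> (!) xs ` {..<j}"
    then obtain a where "a < j" and y: "y = xs ! a"
      by blast
    then have a: "a \<le> j - 1"
      by simp
    have "j - 1 < K"
      using j by auto
    then have "p (xs ! a) \<ge> p (xs ! (j - 1))"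
      using anti[of a "j - 1"] a by (cases "a = j - 1") auto
    moreover have "y \<in> {1..K}"
      using y a j len set_xs nth_mem[of a xs] by auto
    ultimately show "y \<in> {y \<in> {1..K}. p y \<ge> p (xs ! (j - 1))}"
      using y by simp
  qed
  moreover have "inj_on ((!) xs) {..<j}"
    using dist len j by (intro inj_on_nth) auto
  ultimately show "label_rank K p (jth_label K p j) = j"
    by (simp add: label_rank_def jth card_image)
qed

text \<open>Trades positions in the sorted list for ranks, the quantity that the score
  penalises.\<close>

lemma top_set_eq:
  assumes inj: "inj_on p {1..K}" and "k \<le> K"
  shows "top_set K p k = {y \<in> {1..K}. label_rank K p y \<le> k}"
proof (intro subset_antisym subsetI)
  fix y assume "y \<in> top_set K p k"
  then show "y \<in> {y \<in> {1..K}. label_rank K p y \<le> k}"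
    using jth_label_in[OF inj] label_rank_jth_label[OF inj] \<open>k \<le> K\<close>
    unfolding top_set_def by fastforce
next
  fix y assume y: "y \<in> {y \<in> {1..K}. label_rank K p y \<le> k}"
  \<comment> \<open>With \<open>label_rank\<close> as left inverse, \<open>jth_label\<close> is an
    injective self-map of a finite set, hence onto: every label occurs at some position.\<close>
  have "inj_on (jth_label K p) {1..K}"
    by (rule inj_on_inverseI[where g = "label_rank K p"]) (rule label_rank_jth_label[OF inj])
  then have "jth_label K p ` {1..K} = {1..K}"
    using jth_label_in[OF inj] by (intro endo_inj_surj) auto
  then obtain j where "j \<in> {1..K}" "y = jth_label K p j"
    using y by blast
  then show "y \<in> top_set K p k"
    using y label_rank_jth_label[OF inj] unfolding top_set_def by auto
qed

lemma mass_above_nonneg: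
  assumes "\<And>y. y \<in> {1..K} \<Longrightarrow> p y \<ge> 0"
  shows "mass_above K p y \<ge> 0"
  unfolding mass_above_def using assms by (intro sum_nonneg) auto

lemma mass_above_add_le_sum:
  assumes nonneg: "\<And>y. y \<in> {1..K} \<Longrightarrow> p y \<ge> 0" and y: "y \<in> {1..K}"
  shows "mass_above K p y + p y \<le> sum p {1..K}"
proof -
  \<comment> \<open>Writing \<open>p y\<close> as a sum over all labels allows a termwise
    comparison: the two indicators are never both 1.\<close>
  have "mass_above K p y + p y
      = (\<Sum>y'\<in>{1..K}. p y' * of_bool (p y' > p y)) + (\<Sum>y'\<in>{1..K}. p y' * of_bool (y' = y))"
    using y by (simp add: mass_above_def of_bool_def if_distrib sum.delta cong: if_cong)
  also have "\<dots> = (\<Sum>y'\<in>{1..K}. p y' * of_bool (p y' > p y) + p y' * of_bool (y' = y))"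
    by (simp add: sum.distrib)
  also have "\<dots> \<le> sum p {1..K}"
    using nonneg by (intro sum_mono) (auto simp: of_bool_def)
  finally show ?thesis .
qed

text \<open>A rank of at least 2 yields a second label at least as likely as \<open>y\<close>.
  Distinctness makes it strictly more likely, so its own probability is positive and enters the
  sum.\<close>

lemma mass_above_pos:
  assumes inj: "inj_on p {1..K}" and nonneg: "\<And>y. y \<in> {1..K} \<Longrightarrow> p y \<ge> 0"
    and y: "y \<in> {1..K}" and rank: "label_rank K p y \<ge> 2"
  shows "mass_above K p y > 0"
proof -
  have "\<not> {y' \<in> {1..K}. p y' \<ge> p y} \<subseteq> {y}"
    using rank card_mono[of "{y}" "{y' \<in> {1..K}. p y' \<ge> p y}"]
    unfolding label_rank_def by auto
  then obtain z where z: "z \<in> {1..K}" "p z \<ge> p y" "z \<noteq> y"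
    by blast
  then have "p z > p y"
    using inj_onD[OF inj, of z y] y by fastforce
  moreover from this have "p z > 0"
    using nonneg[OF y] by simp
  ultimately show ?thesis
    unfolding mass_above_def using z nonneg
    by (intro sum_pos2[of "{1..K}" z]) auto
qed

text \<open>All three terms of the score are nonnegative. This keeps the thresholds with sufficient
  coverage bounded below by 0.\<close>

lemma C_star_eq_empty:
  assumes nonneg: "\<And>y. y \<in> {1..K} \<Longrightarrow> p y \<ge> 0" and "u \<ge> 0" "lam \<ge> 0" "\<tau> < 0"
  shows "C_star K p lam k_reg u \<tau> = {}"
proof -
  have "mass_above K p y + p y * u + lam * max (real (label_rank K p y) - k_reg) 0 \<ge> 0"
    if "y \<in> {1..K}" for y
    using mass_above_nonneg[of K p y] nonneg that assms(2,3) by (intro add_nonneg_nonneg) auto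
  then show ?thesis
    using \<open>\<tau> < 0\<close> unfolding C_star_def by fastforce
qed

lemma top_set_subset_C_star:
  assumes inj: "inj_on p {1..K}" and nonneg: "\<And>y. y \<in> {1..K} \<Longrightarrow> p y \<ge> 0"
    and total: "sum p {1..K} = 1" and "u \<le> 1" and k: "k \<le> K" "k_reg \<le> real k"
  shows "top_set K p k \<subseteq> C_star K p 1 k_reg u (1 + (real k - k_reg))"
proof
  fix y assume "y \<in> top_set K p k"
  then have y: "y \<in> {1..K}" and rank: "label_rank K p y \<le> k"
    by (auto simp: top_set_eq[OF inj k(1)])
  have "p y * u \<le> p y"
    using nonneg[OF y] \<open>u \<le> 1\<close> by (rule mult_left_le[rotated])
  moreover have "mass_above K p y + p y \<le> 1"
    using mass_above_add_le_sum[of K p y] nonneg y total by simp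
  \<comment> \<open>The bound \<open>k_reg \<le> k\<close> covers the case where the positive part
    vanishes.\<close>
  moreover have "max (real (label_rank K p y) - k_reg) 0 \<le> real k - k_reg"
    using rank k(2) by simp
  ultimately show "y \<in> C_star K p 1 k_reg u (1 + (real k - k_reg))"
    unfolding C_star_def using y by fastforce
qed

lemma C_star_subset_top_set:
  assumes inj: "inj_on p {1..K}" and nonneg: "\<And>y. y \<in> {1..K} \<Longrightarrow> p y \<ge> 0"
    and "u \<ge> 0" and k: "1 \<le> k" "k \<le> K" and \<tau>: "\<tau> \<le> 1 + (real k - k_reg)"
  shows "C_star K p 1 k_reg u \<tau> \<subseteq> top_set K p k"
proof
  fix y assume "y \<in> C_star K p 1 k_reg u \<tau>"
  then have y: "y \<in> {1..K}"
    and le: "mass_above K p y + p y * u + max (real (label_rank K p y) - k_reg) 0 \<le> \<tau>"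
    unfolding C_star_def by auto
  have "label_rank K p y \<le> k"
  proof (rule ccontr)
    assume "\<not> label_rank K p y \<le> k"
    then have rank: "label_rank K p y \<ge> Suc k"
      by simp
    \<comment> \<open>Since \<open>k \<ge> 1\<close>, the rank is at least 2. This term alone makes
      the final inequality strict.\<close>
    have "mass_above K p y > 0"
      using mass_above_pos[OF inj _ y] nonneg rank k(1) by simp
    moreover have "p y * u \<ge> 0"
      using nonneg[OF y] \<open>u \<ge> 0\<close> by simp
    \<comment> \<open>Ranks are integers, so exceeding \<open>k\<close> costs at least one full unit
      of penalty at weight 1, which matches the bound 1 on the randomised mass.\<close>
    moreover have "max (real (label_rank K p y) - k_reg) 0 \<ge> 1 + (real k - k_reg)"
      using rank by simp
    ultimately show False
      using le \<tau> by linarith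
  qed
  then show "y \<in> top_set K p k"
    using y by (simp add: top_set_eq[OF inj k(2)])
qed

lemma calib_coverage_mono:
  assumes "calib_coverage n \<alpha> y A" and "\<And>i. i \<in> {1..n} \<Longrightarrow> A i \<subseteq> B i"
  shows "calib_coverage n \<alpha> y B"
proof -
  have "card {i \<in> {1..n}. y i \<in> A i} \<le> card {i \<in> {1..n}. y i \<in> B i}"
    using assms(2) by (intro card_mono) auto
  then have "real (card {i \<in> {1..n}. y i \<in> A i}) / real n
      \<le> real (card {i \<in> {1..n}. y i \<in> B i}) / real n"
    by (intro divide_right_mono) auto
  then show ?thesis
    using assms(1) unfolding calib_coverage_def by linarith
qed

lemma not_calib_coverage_empty:
  assumes "\<alpha> < 1" "n \<ge> 1" and "\<And>i. i \<in> {1..n} \<Longrightarrow> A i = {}"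
  shows "\<not> calib_coverage n \<alpha> y A"
proof -
  have none: "{i \<in> {1..n}. y i \<in> A i} = {}"
    using assms(3) by auto
  have "\<lceil>(real n + 1) * (1 - \<alpha>)\<rceil> > 0"
    using assms(1) by simp
  \<comment> \<open>For \<open>n = 0\<close> both quotients would be 0 by convention and the
    coverage condition would hold trivially.\<close>
  then have "real_of_int \<lceil>(real n + 1) * (1 - \<alpha>)\<rceil> / real n > 0"
    using assms(2) by (intro divide_pos_pos) auto
  then show ?thesis
    unfolding calib_coverage_def none by simp
qed

lemma k_star_props:
  assumes "\<exists>k\<in>{1..K}. calib_coverage n \<alpha> y (\<lambda>i. top_set K (\<pi> (x i)) k)"
  shows "k_star K \<pi> n \<alpha> x y \<in> {1..K}"
    and "calib_coverage n \<alpha> y (\<lambda>i. top_set K (\<pi> (x i)) (k_star K \<pi> n \<alpha> x y))"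
proof -
  let ?P = "\<lambda>k. k \<in> {1..K} \<and> calib_coverage n \<alpha> y (\<lambda>i. top_set K (\<pi> (x i)) k)"
  have "?P (k_star K \<pi> n \<alpha> x y)"
    unfolding k_star_def using assms by (intro LeastI_ex[of ?P]) auto
  then show "k_star K \<pi> n \<alpha> x y \<in> {1..K}"
    and "calib_coverage n \<alpha> y (\<lambda>i. top_set K (\<pi> (x i)) (k_star K \<pi> n \<alpha> x y))"
    by auto
qed

text \<open>On the reals, \<open>Inf\<close> is the infimum only for nonempty sets that are bounded below: the bound 0
  holds because \<open>\<alpha> < 1\<close> and \<open>n \<ge> 1\<close> make the required coverage positive.\<close>

lemma tau_ccal_le:
  assumes nonneg: "\<And>x y. y \<in> {1..K} \<Longrightarrow> \<pi> x y \<ge> 0" and "lam \<ge> 0"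
    and "\<alpha> < 1" "n \<ge> 1" and u: "\<And>i. i \<in> {1..n} \<Longrightarrow> u i \<ge> 0"
    and cov: "calib_coverage n \<alpha> y (\<lambda>i. C_star K (\<pi> (x i)) lam k_reg (u i) \<tau>)"
  shows "tau_ccal K \<pi> lam k_reg n \<alpha> x y u \<le> \<tau>"
  unfolding tau_ccal_def
proof (rule cInf_lower)
  show "\<tau> \<in> {\<tau>. calib_coverage n \<alpha> y (\<lambda>i. C_star K (\<pi> (x i)) lam k_reg (u i) \<tau>)}"
    using cov by simp
  show "bdd_below {\<tau>. calib_coverage n \<alpha> y (\<lambda>i. C_star K (\<pi> (x i)) lam k_reg (u i) \<tau>)}"
  proof (rule bdd_belowI[where m = 0], rule ccontr)
    fix t assume t: "t \<in> {\<tau>. calib_coverage n \<alpha> y (\<lambda>i. C_star K (\<pi> (x i)) lam k_reg (u i) \<tau>)}"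
      and "\<not> 0 \<le> t"
    then have "C_star K (\<pi> (x i)) lam k_reg (u i) t = {}" if "i \<in> {1..n}" for i
      using nonneg u[OF that] \<open>lam \<ge> 0\<close> by (intro C_star_eq_empty) auto
    from not_calib_coverage_empty[OF \<open>\<alpha> < 1\<close> \<open>n \<ge> 1\<close> this] t show False
      by simp
  qed
qed

theorem proposition2:
  fixes M :: "'w measure"
    and X :: "nat \<Rightarrow> 'w \<Rightarrow> real ^ 'd"
    and Y :: "nat \<Rightarrow> 'w \<Rightarrow> nat"
    and U :: "nat \<Rightarrow> 'w \<Rightarrow> real"
    and \<pi> :: "real ^ 'd \<Rightarrow> nat \<Rightarrow> real"
    and K n :: nat and \<alpha> k_reg :: real and \<omega> :: 'w
  assumes classifier_measurable: "\<And>y. y \<in> {1..K} \<Longrightarrow> (\<lambda>x. \<pi> x y) \<in> borel_measurable borel"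
    and classifier_nonneg: "\<And>x y. y \<in> {1..K} \<Longrightarrow> \<pi> x y \<ge> 0"
    and classifier_sum: "\<And>x. (\<Sum>y\<in>{1..K}. \<pi> x y) = 1"
    and classifier_distinct: "\<And>x. inj_on (\<pi> x) {1..K}"
    and alpha: "0 < \<alpha>" "\<alpha> < 1"
    and n_pos: "n \<ge> 1"
    and prob: "prob_space M"
    and indep: "prob_space.indep_vars M
        (\<lambda>_. borel \<Otimes>\<^sub>M (count_space {1..K} \<Otimes>\<^sub>M borel))
        (\<lambda>i \<omega>. (X i \<omega>, Y i \<omega>, U i \<omega>)) {1..n+1}"
    and ident: "\<And>i. i \<in> {1..n+1} \<Longrightarrow>
        distr M (borel \<Otimes>\<^sub>M (count_space {1..K} \<Otimes>\<^sub>M borel)) (\<lambda>\<omega>. (X i \<omega>, Y i \<omega>, U i \<omega>))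
        = distr M (borel \<Otimes>\<^sub>M (count_space {1..K} \<Otimes>\<^sub>M borel)) (\<lambda>\<omega>. (X 1 \<omega>, Y 1 \<omega>, U 1 \<omega>))"
    and U_uniform: "\<And>i. i \<in> {1..n+1} \<Longrightarrow> distr M borel (U i) = uniform_measure lborel {0..1}"
    and U_range: "\<And>i \<omega>. i \<in> {1..n+1} \<Longrightarrow> \<omega> \<in> space M \<Longrightarrow> U i \<omega> \<in> {0..1}"
    and outcome: "\<omega> \<in> space M"
    and k_exists: "\<exists>k\<in>{1..K}.
        calib_coverage n \<alpha> (\<lambda>i. Y i \<omega>) (\<lambda>i. top_set K (\<pi> (X i \<omega>)) k)"
    and k_reg: "0 \<le> k_reg" "k_reg \<le> real (k_star K \<pi> n \<alpha> (\<lambda>i. X i \<omega>) (\<lambda>i. Y i \<omega>))"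
  shows "C_star K (\<pi> (X (n+1) \<omega>)) 1 k_reg (U (n+1) \<omega>)
           (tau_ccal K \<pi> 1 k_reg n \<alpha> (\<lambda>i. X i \<omega>) (\<lambda>i. Y i \<omega>) (\<lambda>i. U i \<omega>))
         \<subseteq> top_set K (\<pi> (X (n+1) \<omega>)) (k_star K \<pi> n \<alpha> (\<lambda>i. X i \<omega>) (\<lambda>i. Y i \<omega>))"
proof -
  define k where "k = k_star K \<pi> n \<alpha> (\<lambda>i. X i \<omega>) (\<lambda>i. Y i \<omega>)"
  note k_props = k_star_props[where \<pi> = \<pi> and x = "\<lambda>i. X i \<omega>", OF k_exists, folded k_def]
  have k: "1 \<le> k" "k \<le> K" "k_reg \<le> real k"
    using k_props(1) k_reg(2) by (auto simp: k_def)
  \<comment> \<open>The range of \<open>U\<close> is given pointwise, so the inclusion is obtained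
    for the fixed outcome \<open>\<omega>\<close>, not merely almost surely.\<close>
  have u: "0 \<le> U i \<omega>" "U i \<omega> \<le> 1" if "i \<in> {1..n+1}" for i
    using U_range[OF that outcome] by auto
  have "calib_coverage n \<alpha> (\<lambda>i. Y i \<omega>)
      (\<lambda>i. C_star K (\<pi> (X i \<omega>)) 1 k_reg (U i \<omega>) (1 + (real k - k_reg)))"
    using k_props(2)
  proof (rule calib_coverage_mono)
    fix i assume "i \<in> {1..n}"
    then show "top_set K (\<pi> (X i \<omega>)) k
        \<subseteq> C_star K (\<pi> (X i \<omega>)) 1 k_reg (U i \<omega>) (1 + (real k - k_reg))"
      using classifier_distinct classifier_nonneg classifier_sum u k
      by (intro top_set_subset_C_star) auto
  qed
  \<comment> \<open>The threshold just shown to give enough coverage belongs to the set whose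
    infimum is taken.\<close>
  then have "tau_ccal K \<pi> 1 k_reg n \<alpha> (\<lambda>i. X i \<omega>) (\<lambda>i. Y i \<omega>) (\<lambda>i. U i \<omega>) \<le> 1 + (real k - k_reg)"
    using classifier_nonneg alpha(2) n_pos u by (intro tau_ccal_le) auto
  then show ?thesis
    unfolding k_def[symmetric] using classifier_distinct classifier_nonneg u k
    by (intro C_star_subset_top_set) auto
qed

end
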